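(* If $E$ is the orbit equivalence relation of a Polish group action $\Gamma\curvearrowright X$ on a Polish space $X$, then $E$ is strongly Borel $3$-hypergraphable.
   Context: An analytic equivalence relation $E$ on $X$ is strongly Borel $n$-hypergraphable if there is a Borel hypergraph $G$ on $X$ (a Borel set of hyperedges, each a set of at most $n$ points of $X$, e.g. coded as a Borel subset of $X^n$) such that every hyperedge is contained in a single $E$-class, and whenever $x\,E\,y$ there is a hyperedge containing both $x$ and $y$. *)

theory Defs
  imports "HOL-Analysis.Analysis"
begin

text \<open>
  Groups are written additively, as the library's topological groups are; they are not assumed
  to be commutative. A Polish group is a type of sort
  \<^verbatim>\<open>{polish_space, topological_group_add}\<close>.
\<close>

definition continuous_group_action ::
  "('g::topological_group_add \<Rightarrow> 'a::topological_space \<Rightarrow> 'a) \<Rightarrow> bool" where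
  "continuous_group_action act \<longleftrightarrow>
     (\<forall>x. act 0 x = x) \<and>
     (\<forall>g h x. act (g + h) x = act g (act h x)) \<and>
     continuous_on UNIV (\<lambda>(g, x). act g x)"

definition orbit_equivalence :: "('g \<Rightarrow> 'a \<Rightarrow> 'a) \<Rightarrow> ('a \<times> 'a) set" where
  "orbit_equivalence act = {(x, y). \<exists>g. y = act g x}"

text \<open>
  The function type \<^typ>\<open>nat \<Rightarrow> nat\<close> carries the product topology of the discrete
  topology, so it is the Baire space.
\<close>

definition analytic_set :: "'a::topological_space set \<Rightarrow> bool" where
  "analytic_set A \<longleftrightarrow>
     A = {} \<or> (\<exists>f :: (nat \<Rightarrow> nat) \<Rightarrow> 'a. continuous_on UNIV f \<and> A = range f)"

text \<open>
  A family of sets of at most \<open>n\<close> points is Borel if the set of all \<open>n\<close>-tuples (repetitions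
  allowed) enumerating a member of the family is Borel in the \<open>n\<close>-th power of the space. On a
  second countable space the product \<open>\<sigma>\<close>-algebra used here is the Borel \<open>\<sigma>\<close>-algebra of that power.
\<close>

definition borel_hypergraph :: "nat \<Rightarrow> 'a::polish_space set set \<Rightarrow> bool" where
  "borel_hypergraph n G \<longleftrightarrow>
     (\<forall>e\<in>G. finite e \<and> card e \<le> n) \<and>
     {t \<in> {..<n} \<rightarrow>\<^sub>E UNIV. t ` {..<n} \<in> G} \<in> sets (Pi\<^sub>M {..<n} (\<lambda>_. borel))"

definition strongly_borel_hypergraphable ::
  "nat \<Rightarrow> ('a::polish_space \<times> 'a) set \<Rightarrow> bool" where
  "strongly_borel_hypergraphable n E \<longleftrightarrow>
     equiv UNIV E \<and> analytic_set E \<and>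
     (\<exists>G. borel_hypergraph n G \<and>
          (\<forall>e\<in>G. \<exists>C\<in>UNIV // E. e \<subseteq> C) \<and>
          (\<forall>x y. (x, y) \<in> E \<longrightarrow> (\<exists>e\<in>G. x \<in> e \<and> y \<in> e)))"

end

theory Submission
  imports Defs
begin

text \<open>
  If the stabilizer of \<open>x\<close> is open, then a countable dense set of group elements already moves
  \<open>x\<close> to every point of its orbit, and the hyperedges \<open>{x, d x}\<close> suffice. Otherwise every
  neighbourhood of every group element contains elements moving \<open>x\<close> to different places, and from
  \<open>x\<close> one builds, in a Borel way, a Cantor scheme of group elements \<open>h\<^sub>\<alpha>\<close>, with \<open>\<alpha>\<close> an infinite
  binary sequence, such that \<open>\<alpha>\<close> can be read off \<open>x\<close> and \<open>z = h\<^sub>\<alpha> x\<close>. Given \<open>y = g x\<close>, let \<open>\<alpha>\<close> code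
  \<open>g\<close>: the third point \<open>z\<close> of the hyperedge \<open>{x, y, z}\<close> then witnesses, in a Borel way, that
  all three points lie in one orbit.
\<close>

section \<open>Dense sequences and rapidly converging sequences\<close>

lemma dense_sequence_exists:
  obtains D :: "nat \<Rightarrow> 'a::second_countable_topology"
  where "\<And>U. open U \<Longrightarrow> U \<noteq> {} \<Longrightarrow> \<exists>n. D n \<in> U"
proof -
  obtain A :: "'a set" where A: "countable A" "\<And>U. open U \<Longrightarrow> U \<noteq> {} \<Longrightarrow> \<exists>d\<in>A. d \<in> U"
    using countable_dense_setE by blast
  have "A \<noteq> {}" using A(2)[of UNIV] by auto
  with A(1) have "range (from_nat_into A) = A" by (rule range_from_nat_into[rotated])
  with A(2) show ?thesis
    by (intro that[of "from_nat_into A"]) (metis imageE)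
qed

lemma Cauchy_geometric:
  fixes s :: "nat \<Rightarrow> 'a::metric_space"
  assumes "\<And>m n. n \<le> m \<Longrightarrow> dist (s m) (s n) \<le> c * (1/2) ^ n"
  shows "Cauchy s"
proof (rule metric_CauchyI)
  fix e :: real assume "e > 0"
  have "(\<lambda>n. c * (1/2::real) ^ n) \<longlonglongrightarrow> c * 0"
    by (intro tendsto_intros LIMSEQ_power_zero) auto
  then have "\<forall>\<^sub>F n in sequentially. c * (1/2::real) ^ n < e/2"
    using \<open>e > 0\<close> by (intro order_tendstoD) auto
  then obtain N where N: "c * (1/2::real) ^ N < e/2"
    by (auto simp: eventually_sequentially)
  show "\<exists>N. \<forall>m\<ge>N. \<forall>n\<ge>N. dist (s m) (s n) < e"
  proof (intro exI[of _ N] allI impI)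
    fix m n assume "N \<le> m" "N \<le> n"
    then show "dist (s m) (s n) < e"
      using assms[of N m] assms[of N n] N dist_triangle2[of "s m" "s n" "s N"] by linarith
  qed
qed

section \<open>Polish spaces are continuous images of the Baire space\<close>

text \<open>A jump to a point that is too far away is replaced by standing still, so that every
  \<open>\<alpha>\<close> yields a sequence with geometrically decreasing steps.\<close>

primrec approx_index :: "(nat \<Rightarrow> 'a::metric_space) \<Rightarrow> (nat \<Rightarrow> nat) \<Rightarrow> nat \<Rightarrow> nat" where
  "approx_index D \<alpha> 0 = \<alpha> 0"
| "approx_index D \<alpha> (Suc n) =
     (if dist (D (\<alpha> (Suc n))) (D (approx_index D \<alpha> n)) < (1/2) ^ n
      then \<alpha> (Suc n) else approx_index D \<alpha> n)"

text \<open>The bound is the geometric sum of the steps from \<open>n\<close> to \<open>m\<close>;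
  keeping the subtracted term lets the induction close.\<close>

lemma approx_index_dist:
  assumes "n \<le> m"
  shows "dist (D (approx_index D \<alpha> m)) (D (approx_index D \<alpha> n)) \<le> 2 * (1/2) ^ n - 2 * (1/2) ^ m"
  using assms
proof (induction m rule: dec_induct)
  case base
  then show ?case by simp
next
  case (step m)
  have "dist (D (approx_index D \<alpha> (Suc m))) (D (approx_index D \<alpha> m)) \<le> (1/2) ^ m"
    by auto
  then show ?case
    using step.IH dist_triangle[of "D (approx_index D \<alpha> (Suc m))" "D (approx_index D \<alpha> n)"
        "D (approx_index D \<alpha> m)"]
    by (simp del: approx_index.simps)
qed

text \<open>Only finitely many values of \<alpha> are read, which is what makes the limit map
  continuous.\<close>

lemma approx_index_cong:
  assumes "\<And>i. i \<le> n \<Longrightarrow> \<alpha> i = \<beta> i"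
  shows "approx_index D \<alpha> n = approx_index D \<beta> n"
  using assms by (induction n) auto

lemma open_agree_upto:
  fixes \<alpha> :: "nat \<Rightarrow> nat"
  shows "open {\<beta>. \<forall>i\<le>n. \<beta> i = \<alpha> i}"
proof -
  have "open (\<Inter>i\<in>{..n}. (\<lambda>\<beta>::nat \<Rightarrow> nat. \<beta> i) -` {\<alpha> i})"
    by (intro open_INT ballI open_vimage continuous_on_product_coordinates open_discrete) auto
  also have "(\<Inter>i\<in>{..n}. (\<lambda>\<beta>. \<beta> i) -` {\<alpha> i}) = {\<beta>. \<forall>i\<le>n. \<beta> i = \<alpha> i}"
    by auto
  finally show ?thesis .
qed

lemma baire_space_surjection:
  obtains f :: "(nat \<Rightarrow> nat) \<Rightarrow> 'a::{complete_space, second_countable_topology}"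
  where "continuous_on UNIV f" "range f = UNIV"
proof -
  obtain D :: "nat \<Rightarrow> 'a" where D: "\<And>U. open U \<Longrightarrow> U \<noteq> {} \<Longrightarrow> \<exists>n. D n \<in> U"
    using dense_sequence_exists by blast
  define q where "q \<alpha> n = D (approx_index D \<alpha> n)" for \<alpha> n
  define f where "f \<alpha> = lim (q \<alpha>)" for \<alpha>
  have d: "dist (q \<alpha> m) (q \<alpha> n) \<le> 2 * (1/2) ^ n" if "n \<le> m" for \<alpha> m n
    using approx_index_dist[OF that, of D \<alpha>] zero_le_power[of "1/2::real" m] unfolding q_def
    by linarith
  have "Cauchy (q \<alpha>)" for \<alpha>
    using d by (rule Cauchy_geometric)
  then have lim: "q \<alpha> \<longlonglongrightarrow> f \<alpha>" for \<alpha>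
    unfolding f_def by (simp add: Cauchy_convergent_iff convergent_LIMSEQ_iff)
  have df: "dist (f \<alpha>) (q \<alpha> n) \<le> 2 * (1/2) ^ n" for \<alpha> n
    using d by (intro LIMSEQ_le_const2[OF tendsto_dist[OF lim tendsto_const]]) blast
  have cont: "(f \<longlongrightarrow> f \<alpha>) (at \<alpha>)" for \<alpha>
    unfolding tendsto_iff
  proof (intro allI impI)
    fix e :: real assume "e > 0"
    then obtain n where n: "(1/2::real) ^ n < e/4"
      using real_arch_pow_inv[of "e/4" "1/2"] by auto
    have "dist (f \<beta>) (f \<alpha>) < e" if "\<forall>i\<le>n. \<beta> i = \<alpha> i" for \<beta>
    proof -
      have "q \<beta> n = q \<alpha> n"
        unfolding q_def using approx_index_cong[of n \<beta> \<alpha> D] that by simp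
      then show ?thesis
        using df[of \<beta> n] df[of \<alpha> n] n dist_triangle2[of "f \<beta>" "f \<alpha>" "q \<alpha> n"] by simp
    qed
    then show "\<forall>\<^sub>F \<beta> in at \<alpha>. dist (f \<beta>) (f \<alpha>) < e"
      unfolding eventually_at_topological
      by (intro exI[of _ "{\<beta>. \<forall>i\<le>n. \<beta> i = \<alpha> i}"]) (auto simp: open_agree_upto)
  qed
  have "p \<in> range f" for p
  proof -
    \<comment> \<open>With these radii consecutive points differ by less than
      \<open>(1/2) ^ n\<close>, so \<open>approx_index\<close> never stands still.\<close>
    have "\<forall>n. \<exists>m. D m \<in> ball p ((1/2) ^ Suc (Suc n))"
      by (intro allI D) (auto simp: not_le)
    then obtain \<alpha> where \<alpha>: "\<And>n. dist p (D (\<alpha> n)) < (1/2) ^ Suc (Suc n)"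
      by (metis mem_ball)
    have "approx_index D \<alpha> n = \<alpha> n" for n
    proof (induction n)
      case (Suc n)
      have "dist (D (\<alpha> (Suc n))) (D (\<alpha> n)) < (1/2) ^ n"
        using \<alpha>[of n] \<alpha>[of "Suc n"] dist_triangle3[of "D (\<alpha> (Suc n))" "D (\<alpha> n)" p]
          zero_less_power[of "1/2::real" n] unfolding power_Suc by linarith
      with Suc show ?case by simp
    qed simp
    then have "q \<alpha> = (\<lambda>n. D (\<alpha> n))" by (simp add: q_def fun_eq_iff)
    moreover have "(\<lambda>n. D (\<alpha> n)) \<longlonglongrightarrow> p"
    proof (rule tendsto_dist_iff[THEN iffD2], rule tendsto_sandwich[where f = "\<lambda>_. 0"])
      show "\<forall>\<^sub>F n in sequentially. dist (D (\<alpha> n)) p \<le> (1/2) ^ Suc (Suc n)"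
        using \<alpha> by (intro always_eventually allI less_imp_le) (simp add: dist_commute)
      show "(\<lambda>n. (1/2::real) ^ Suc (Suc n)) \<longlonglongrightarrow> 0"
        by (intro LIMSEQ_Suc LIMSEQ_power_zero) auto
    qed auto
    ultimately have "f \<alpha> = p"
      using lim[of \<alpha>] by (simp add: LIMSEQ_unique)
    then show ?thesis by blast
  qed
  then show ?thesis
    using cont by (intro that[of f]) (auto simp: continuous_on_def)
qed

lemma analytic_set_continuous_range:
  fixes f :: "'a::{complete_space, second_countable_topology} \<Rightarrow> 'b::topological_space"
  assumes "continuous_on UNIV f"
  shows "analytic_set (range f)"
proof -
  obtain b :: "(nat \<Rightarrow> nat) \<Rightarrow> 'a" where "continuous_on UNIV b" and b: "range b = UNIV"
    by (rule baire_space_surjection)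
  then have "continuous_on UNIV (f \<circ> b)"
    using assms by (intro continuous_on_compose) auto
  moreover have "range f = range (f \<circ> b)"
    using b by (metis image_comp)
  ultimately show ?thesis
    unfolding analytic_set_def by blast
qed

section \<open>Coding group elements into points of an orbit\<close>

locale polish_action =
  fixes act :: "'g::{polish_space, topological_group_add} \<Rightarrow> 'a::polish_space \<Rightarrow> 'a"
    and D :: "nat \<Rightarrow> 'g"
  assumes action: "continuous_group_action act"
    and dense: "open U \<Longrightarrow> U \<noteq> {} \<Longrightarrow> \<exists>n. D n \<in> U"
begin

lemma act_0 [simp]: "act 0 x = x"
  and act_add: "act (g + h) x = act g (act h x)"
  and continuous_act: "continuous_on UNIV (\<lambda>(g, x). act g x)"
  using action by (auto simp: continuous_group_action_def)

lemma tendsto_act: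
  assumes "(f \<longlongrightarrow> g) F"
  shows "((\<lambda>n. act (f n) x) \<longlongrightarrow> act g x) F"
  using continuous_on_tendsto_compose[OF continuous_act tendsto_Pair[OF assms tendsto_const]]
  by simp

lemma continuous_act_left: "continuous_on UNIV (\<lambda>g. act g x)"
  unfolding continuous_on_def by (auto intro: tendsto_act)

lemma measurable_act [measurable]: "act g \<in> borel_measurable borel"
proof (rule borel_measurable_continuous_onI)
  have "continuous_on UNIV ((\<lambda>(g, x). act g x) \<circ> (\<lambda>x. (g, x)))"
    by (intro continuous_on_compose continuous_intros continuous_on_subset[OF continuous_act]) auto
  then show "continuous_on UNIV (act g)" by (simp add: o_def)
qed

section \<open>Borel witnesses for lying in an orbit, and the Cantor scheme\<close>

definition orbit_limit :: "(nat \<Rightarrow> nat) \<Rightarrow> 'a \<Rightarrow> 'a \<Rightarrow> bool" where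
  "orbit_limit u x y \<longleftrightarrow> Cauchy (\<lambda>n. D (u n)) \<and> (\<lambda>n. act (D (u n)) x) \<longlonglongrightarrow> y"

lemma orbit_limitI:
  assumes "(\<lambda>n. D (u n)) \<longlonglongrightarrow> g"
  shows "orbit_limit u x (act g x)"
  using assms by (auto simp: orbit_limit_def intro: tendsto_act LIMSEQ_imp_Cauchy)

text \<open>Completeness of the group turns the Cauchy condition into a group element. So
  \<open>orbit_limit\<close> certifies membership in an orbit without a quantifier over the
  group.\<close>

lemma orbit_limit_in_orbit:
  assumes "orbit_limit u x y"
  obtains g where "y = act g x"
proof -
  obtain g where "(\<lambda>n. D (u n)) \<longlonglongrightarrow> g"
    using assms by (auto simp: orbit_limit_def Cauchy_convergent_iff convergent_def)
  then have "y = act g x"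
    using assms by (auto simp: orbit_limit_def intro: LIMSEQ_unique tendsto_act)
  then show ?thesis by (rule that)
qed

text \<open>A state \<open>(i, k)\<close> stands for the ball of radius \<open>(1/2) ^ k\<close> around \<open>D i\<close>. The next state is
  a smaller ball around \<open>D i\<close> or around \<open>D j\<close>, where \<open>D j\<close> lies in the old ball and moves \<open>x\<close> to
  another point than \<open>D i\<close> does.\<close>

definition branch :: "'a \<Rightarrow> nat \<Rightarrow> nat \<Rightarrow> nat" where
  "branch x i k = (LEAST j. dist (D j) (D i) < (1/2) ^ k \<and> act (D j) x \<noteq> act (D i) x)"

text \<open>The second conjunct nests the balls. The factor 1/3 keeps the images under the two
  candidate centres apart, so that a limit point reveals which was chosen. Testing only the dense
  sequence keeps the condition Borel.\<close>

definition shrinks :: "'a \<Rightarrow> nat \<Rightarrow> nat \<Rightarrow> nat \<Rightarrow> nat \<Rightarrow> bool" where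
  "shrinks x i k i' k' \<longleftrightarrow> k < k' \<and> dist (D i') (D i) + (1/2) ^ k' \<le> (1/2) ^ k \<and>
     (\<forall>l. dist (D l) (D i') < (1/2) ^ k' \<longrightarrow>
        dist (act (D l) x) (act (D i') x) \<le> dist (act (D i) x) (act (D (branch x i k)) x) / 3)"

fun refine :: "'a \<Rightarrow> nat \<times> nat \<Rightarrow> bool \<Rightarrow> nat \<times> nat" where
  "refine x (i, k) b =
     (let i' = if b then branch x i k else i in (i', LEAST k'. shrinks x i k i' k'))"

text \<open>The rule \<beta> sees both the stage and the current state: encoding uses only the
  stage, decoding only the state.\<close>

primrec scheme :: "'a \<Rightarrow> (nat \<Rightarrow> nat \<times> nat \<Rightarrow> bool) \<Rightarrow> nat \<Rightarrow> nat \<times> nat" where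
  "scheme x \<beta> 0 = (0, 0)"
| "scheme x \<beta> (Suc n) = refine x (scheme x \<beta> n) (\<beta> n (scheme x \<beta> n))"

fun closer :: "'a \<Rightarrow> 'a \<Rightarrow> nat \<times> nat \<Rightarrow> bool" where
  "closer x z (i, k) \<longleftrightarrow> dist z (act (D (branch x i k)) x) < dist z (act (D i) x)"

text \<open>Reruns the scheme with each bit read off from \<open>z\<close>, so the states are
  recovered without knowing the coding sequence.\<close>

definition trace :: "'a \<Rightarrow> 'a \<Rightarrow> nat \<Rightarrow> nat \<times> nat" where
  "trace x z = scheme x (\<lambda>_. closer x z)"

text \<open>The bit numbered \<open>prod_encode (n, m)\<close> is meant to say that
  \<open>D m\<close> is within \<open>(1/2) ^ n\<close> of the coded element, so the least such
  \<open>m\<close> gives an approximation to it.\<close>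

definition decode :: "'a \<Rightarrow> 'a \<Rightarrow> nat \<Rightarrow> nat" where
  "decode x z n = (LEAST m. closer x z (trace x z (prod_encode (n, m))))"

text \<open>The first alternative serves open stabilizers, with \<open>x\<close> repeated as a dummy
  third point. In the second, convergence alone forces \<open>y\<close> and \<open>z\<close> into
  the orbit, whatever a \<open>LEAST\<close> without solution returns.\<close>

definition edge :: "'a \<Rightarrow> 'a \<Rightarrow> 'a \<Rightarrow> bool" where
  "edge x y z \<longleftrightarrow> (z = x \<and> (\<exists>j. y = act (D j) x)) \<or>
     (orbit_limit (\<lambda>n. fst (trace x z n)) x z \<and> orbit_limit (decode x z) x y)"

lemma edge_in_orbit:
  assumes "edge x y z"
  shows "\<exists>g. y = act g x" "\<exists>g. z = act g x"
  using assms act_0[of x, symmetric] unfolding edge_def by (blast elim: orbit_limit_in_orbit)+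

subsection \<open>Borel measurability\<close>

lemma pred_eq_borel:
  fixes f g :: "'b \<Rightarrow> 'c::polish_space"
  assumes [measurable]: "f \<in> borel_measurable M" "g \<in> borel_measurable M"
  shows "Measurable.pred M (\<lambda>w. f w = g w)"
proof -
  have "Measurable.pred M (\<lambda>w. dist (f w) (g w) \<le> 0)" by measurable
  then show ?thesis by simp
qed

context
  fixes M :: "'b measure" and X Y Z :: "'b \<Rightarrow> 'a"
  assumes X [measurable]: "X \<in> borel_measurable M"
    and Y [measurable]: "Y \<in> borel_measurable M"
    and Z [measurable]: "Z \<in> borel_measurable M"
begin

lemma measurable_act_dense:
  assumes "u \<in> M \<rightarrow>\<^sub>M count_space UNIV"
  shows "(\<lambda>w. act (D (u w)) (X w)) \<in> borel_measurable M"
  by (rule measurable_compose_countable[OF _ assms]) measurable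

lemma measurable_branch [measurable]: "(\<lambda>w. branch (X w) i k) \<in> M \<rightarrow>\<^sub>M count_space UNIV"
proof -
  note pred_eq_borel [measurable]
  show ?thesis unfolding branch_def by measurable
qed

lemma pred_shrinks [measurable]: "Measurable.pred M (\<lambda>w. shrinks (X w) i k i' k')"
proof -
  note measurable_act_dense [measurable]
  show ?thesis unfolding shrinks_def by measurable
qed

lemma measurable_refine: "(\<lambda>w. refine (X w) s b) \<in> M \<rightarrow>\<^sub>M count_space UNIV"
proof (cases s)
  case (Pair i k)
  have "(\<lambda>w. (i', LEAST k'. shrinks (X w) i k i' k')) \<in> M \<rightarrow>\<^sub>M count_space UNIV" for i'
    by (rule measurable_compose[where f = "\<lambda>w. LEAST k'. shrinks (X w) i k i' k'"]) measurable
  then have "(\<lambda>w. (if b then branch (X w) i k else i,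
      LEAST k'. shrinks (X w) i k (if b then branch (X w) i k else i) k')) \<in> M \<rightarrow>\<^sub>M count_space UNIV"
    by (rule measurable_compose_countable) measurable
  then show ?thesis
    by (simp add: Pair Let_def)
qed

lemma pred_closer: "Measurable.pred M (\<lambda>w. closer (X w) (Z w) s)"
proof (cases s)
  case (Pair i k)
  note measurable_act_dense [measurable]
  show ?thesis by (simp add: Pair) measurable
qed

text \<open>There are countably many states, so feeding one state into the next step is a countable
  case distinction.\<close>

lemma measurable_trace: "(\<lambda>w. trace (X w) (Z w) n) \<in> M \<rightarrow>\<^sub>M count_space UNIV"
proof (induction n)
  case 0
  then show ?case by (simp add: trace_def)
next
  case (Suc n)
  have "(\<lambda>w. refine (X w) s (closer (X w) (Z w) s)) \<in> M \<rightarrow>\<^sub>M count_space UNIV" for s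
    using measurable_refine pred_closer by (rule measurable_compose_countable)
  then have "(\<lambda>w. refine (X w) (trace (X w) (Z w) n) (closer (X w) (Z w) (trace (X w) (Z w) n)))
      \<in> M \<rightarrow>\<^sub>M count_space UNIV"
    using Suc by (rule measurable_compose_countable)
  then show ?case by (simp add: trace_def)
qed

lemma measurable_decode: "(\<lambda>w. decode (X w) (Z w) n) \<in> M \<rightarrow>\<^sub>M count_space UNIV"
  unfolding decode_def
  by (intro measurable_Least measurable_compose_countable[OF pred_closer measurable_trace])

lemma pred_orbit_limit:
  assumes u [measurable]: "\<And>n. (\<lambda>w. u w n) \<in> M \<rightarrow>\<^sub>M count_space UNIV"
    and V [measurable]: "V \<in> borel_measurable M"
  shows "Measurable.pred M (\<lambda>w. orbit_limit (u w) (X w) (V w))"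
proof -
  \<comment> \<open>The radii \<open>inverse (real (Suc j))\<close> leave only countable
    quantifiers.\<close>
  have lim_iff: "s \<longlonglongrightarrow> l \<longleftrightarrow> (\<forall>j. \<exists>N. \<forall>n\<ge>N. dist (s n) l < inverse (real (Suc j)))"
    for s and l :: 'a
  proof
    assume "\<forall>j. \<exists>N. \<forall>n\<ge>N. dist (s n) l < inverse (real (Suc j))"
    then show "s \<longlonglongrightarrow> l"
      unfolding lim_sequentially by (metis less_trans reals_Archimedean)
  qed (simp add: lim_sequentially)
  have [measurable]: "(\<lambda>w. D (u w n)) \<in> borel_measurable M" for n
    by (rule measurable_compose[OF u]) simp
  note measurable_act_dense [OF u, measurable]
  show ?thesis
    unfolding orbit_limit_def lim_iff by measurable
qed

text \<open>With \<open>M\<close> arbitrary, this applies to coordinates of a power of the space in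
  any order.\<close>

lemma pred_edge: "Measurable.pred M (\<lambda>w. edge (X w) (Y w) (Z w))"
proof -
  have "(\<lambda>w. fst (trace (X w) (Z w) n)) \<in> M \<rightarrow>\<^sub>M count_space UNIV" for n
    by (rule measurable_compose[OF measurable_trace]) simp
  note limits = pred_orbit_limit[OF this Z] pred_orbit_limit[OF measurable_decode Y]
  have "(\<lambda>w. act (D j) (X w)) \<in> borel_measurable M" for j
    by measurable
  note equalities = pred_eq_borel[OF Z X] pred_eq_borel[OF Y this]
  show ?thesis
    unfolding edge_def by (intro pred_intros_logic pred_intros_countable limits equalities)
qed

end

subsection \<open>Every pair of points of an orbit lies in an edge\<close>

context
  fixes x :: 'a
  assumes moved: "\<And>i k. \<exists>j. dist (D j) (D i) < (1/2) ^ k \<and> act (D j) x \<noteq> act (D i) x"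
begin

lemma branch: "dist (D (branch x i k)) (D i) < (1/2) ^ k" "act (D (branch x i k)) x \<noteq> act (D i) x"
  using LeastI_ex[OF moved[of i k]] by (auto simp: branch_def)

text \<open>Continuity of the orbit map at \<open>D i'\<close> bounds the images; the strict
  inequality leaves room for a ball inside the old one.\<close>

lemma shrinks_exists:
  assumes "dist (D i') (D i) < (1/2) ^ k"
  shows "\<exists>k'. shrinks x i k i' k'"
proof -
  define \<delta> where "\<delta> = dist (act (D i) x) (act (D (branch x i k)) x) / 3"
  have "\<delta> > 0" using branch(2)[of i k] by (simp add: \<delta>_def)
  then obtain e where e: "e > 0" "\<And>g. dist g (D i') < e \<Longrightarrow> dist (act g x) (act (D i') x) < \<delta>"
    using continuous_act_left[of x] unfolding continuous_on_iff by (metis UNIV_I)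
  then obtain N where N: "(1/2::real) ^ N < min e ((1/2) ^ k - dist (D i') (D i))"
    using assms real_arch_pow_inv[of "min e ((1/2) ^ k - dist (D i') (D i))" "1/2"] by auto
  \<comment> \<open>The maximum with \<open>Suc k\<close> makes the exponent grow strictly.\<close>
  have "(1/2::real) ^ max N (Suc k) \<le> (1/2) ^ N"
    by (intro power_decreasing) auto
  with N have "(1/2::real) ^ max N (Suc k) < e"
    "dist (D i') (D i) + (1/2) ^ max N (Suc k) \<le> (1/2) ^ k"
    by linarith+
  then have "shrinks x i k i' (max N (Suc k))"
    unfolding shrinks_def \<delta>_def[symmetric]
    by (intro conjI allI impI less_imp_le[OF e(2)]) linarith+
  then show ?thesis ..
qed

lemma shrinks_refine: "shrinks x (fst s) (snd s) (fst (refine x s b)) (snd (refine x s b))"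
proof (cases s)
  case (Pair i k)
  define i' where "i' = (if b then branch x i k else i)"
  have "dist (D i') (D i) < (1/2) ^ k"
    using branch(1) by (simp add: i'_def)
  then have "shrinks x i k i' (LEAST k'. shrinks x i k i' k')"
    by (rule LeastI_ex[OF shrinks_exists])
  then show ?thesis by (simp add: Pair Let_def i'_def)
qed

lemma shrinks_scheme:
  "shrinks x (fst (scheme x \<beta> n)) (snd (scheme x \<beta> n))
     (fst (scheme x \<beta> (Suc n))) (snd (scheme x \<beta> (Suc n)))"
  by (simp add: shrinks_refine)

lemma scheme_snd_ge: "n \<le> snd (scheme x \<beta> n)"
proof (induction n)
  case (Suc n)
  then show ?case using shrinks_scheme[of \<beta> n] by (simp add: shrinks_def)
qed simp

text \<open>Nesting written as centre distance plus new radius composes by the triangle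
  inequality.\<close>

lemma scheme_ball:
  assumes "n \<le> m"
  shows "dist (D (fst (scheme x \<beta> m))) (D (fst (scheme x \<beta> n))) + (1/2) ^ snd (scheme x \<beta> m)
    \<le> (1/2) ^ snd (scheme x \<beta> n)"
  using assms
proof (induction m rule: dec_induct)
  case base
  then show ?case by simp
next
  case (step m)
  let ?d = "\<lambda>n. D (fst (scheme x \<beta> n))"
  have "dist (?d (Suc m)) (?d m) + (1/2) ^ snd (scheme x \<beta> (Suc m)) \<le> (1/2) ^ snd (scheme x \<beta> m)"
    using shrinks_scheme unfolding shrinks_def by blast
  then show ?case
    using step.IH dist_triangle[of "?d (Suc m)" "?d n" "?d m"] by linarith
qed

lemma Cauchy_scheme: "Cauchy (\<lambda>n. D (fst (scheme x \<beta> n)))"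
proof (rule Cauchy_geometric[where c = 1])
  fix n m :: nat assume "n \<le> m"
  moreover have "(1/2::real) ^ snd (scheme x \<beta> n) \<le> (1/2) ^ n"
    by (intro power_decreasing scheme_snd_ge) auto
  moreover have "0 \<le> (1/2::real) ^ snd (scheme x \<beta> m)" by simp
  ultimately show "dist (D (fst (scheme x \<beta> m))) (D (fst (scheme x \<beta> n))) \<le> 1 * (1/2) ^ n"
    using scheme_ball[of n m \<beta>] by linarith
qed

text \<open>Once stage \<open>n\<close> has chosen a centre, all later images, hence also
  \<open>z\<close>, stay within a third of the candidates' distance from its image, and the rejected
  image is at least two thirds away. Comparing distances thus reads off \<open>\<alpha> n\<close>,
  and by induction the trace follows the scheme.\<close>

lemma scheme_recoverable:
  assumes z: "(\<lambda>n. act (D (fst (scheme x (\<lambda>n _. \<alpha> n) n))) x) \<longlonglongrightarrow> z"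
  shows "closer x z (scheme x (\<lambda>n _. \<alpha> n) n) \<longleftrightarrow> \<alpha> n"
    and "trace x z n = scheme x (\<lambda>n _. \<alpha> n) n"
proof -
  define s where "s = scheme x (\<lambda>n _. \<alpha> n)"
  have closer: "closer x z (s n) \<longleftrightarrow> \<alpha> n" for n
  proof -
    obtain i k where ik: "s n = (i, k)" by fastforce
    let ?j = "branch x i k"
    let ?\<delta> = "dist (act (D i) x) (act (D ?j) x)"
    have i': "fst (s (Suc n)) = (if \<alpha> n then ?j else i)"
      using ik by (simp add: s_def Let_def)
    have "dist (act (D (fst (s m))) x) (act (D (fst (s (Suc n)))) x) \<le> ?\<delta> / 3"
      if "Suc n \<le> m" for m
    proof -
      have "dist (D (fst (s m))) (D (fst (s (Suc n)))) < (1/2) ^ snd (s (Suc n))"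
        using scheme_ball[OF that, of "\<lambda>n _. \<alpha> n"] zero_less_power[of "1/2::real" "snd (s m)"]
        unfolding s_def by linarith
      then show ?thesis
        using shrinks_scheme[of "\<lambda>n _. \<alpha> n" n] ik unfolding shrinks_def s_def by simp
    qed
    then have "dist z (act (D (fst (s (Suc n)))) x) \<le> ?\<delta> / 3"
      using z unfolding s_def[symmetric]
      by (intro LIMSEQ_le_const2[OF tendsto_dist[OF z[folded s_def] tendsto_const]]) blast
    moreover have "?\<delta> > 0" using branch(2)[of i k] by simp
    moreover have "?\<delta> \<le> dist z (act (D i) x) + dist z (act (D ?j) x)"
      by (rule dist_triangle3)
    ultimately show ?thesis
      unfolding ik closer.simps i' by (cases "\<alpha> n"; simp; linarith)
  qed
  then show "closer x z (scheme x (\<lambda>n _. \<alpha> n) n) \<longleftrightarrow> \<alpha> n"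
    by (simp add: s_def)
  show "trace x z n = scheme x (\<lambda>n _. \<alpha> n) n"
  proof (induction n)
    case (Suc n)
    then show ?case using closer[of n] by (simp add: trace_def s_def)
  qed (simp add: trace_def)
qed

lemma edge_exists_moved: "\<exists>z. edge x (act g x) z"
proof -
  have "\<exists>m. D m \<in> ball g ((1/2) ^ n)" for n
    by (rule dense) (auto simp: ball_eq_empty not_le)
  then have near: "\<exists>m. dist g (D m) < (1/2) ^ n" for n
    by simp
  \<comment> \<open>The bits record which \<open>D m\<close> approximate \<open>g\<close> to which
    precision; by \<open>near\<close> every \<open>n\<close> has a true bit, so the search in
    \<open>decode\<close> succeeds.\<close>
  define \<alpha> where "\<alpha> p = (case prod_decode p of (n, m) \<Rightarrow> dist g (D m) < (1/2) ^ n)" for p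
  obtain h where h: "(\<lambda>n. D (fst (scheme x (\<lambda>n _. \<alpha> n) n))) \<longlonglongrightarrow> h"
    using Cauchy_scheme[of "\<lambda>n _. \<alpha> n"] by (auto simp: Cauchy_convergent_iff convergent_def)
  define z where "z = act h x"
  note recover = scheme_recoverable[OF tendsto_act[OF h, of x, folded z_def]]
  have 1: "orbit_limit (\<lambda>n. fst (trace x z n)) x z"
    using orbit_limitI[OF h, of x] by (simp add: recover(2) z_def[symmetric])
  have "decode x z n = (LEAST m. dist g (D m) < (1/2) ^ n)" for n
    unfolding decode_def recover by (simp add: \<alpha>_def)
  then have decode: "dist g (D (decode x z n)) < (1/2) ^ n" for n
    using LeastI_ex[OF near] by simp
  have "(\<lambda>n. D (decode x z n)) \<longlonglongrightarrow> g"
  proof (rule tendsto_dist_iff[THEN iffD2], rule tendsto_sandwich[where f = "\<lambda>_. 0"])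
    show "\<forall>\<^sub>F n in sequentially. dist (D (decode x z n)) g \<le> (1/2) ^ n"
      using decode by (intro always_eventually allI less_imp_le) (simp add: dist_commute)
    show "(\<lambda>n. (1/2::real) ^ n) \<longlonglongrightarrow> 0"
      by (intro LIMSEQ_power_zero) auto
  qed auto
  with 1 show ?thesis
    unfolding edge_def using orbit_limitI by blast
qed

end

section \<open>Points with open stabilizer, and the case distinction\<close>

lemma dense_orbit_of_constant_ball:
  assumes const: "\<And>j. dist (D j) h < e \<Longrightarrow> act (D j) x = act h x" and "e > 0"
  shows "\<exists>j. act g x = act (D j) x"
proof -
  \<comment> \<open>Elements of the ball moving \<open>x\<close> elsewhere would form a nonempty
    open set, which the dense sequence would meet.\<close>
  have ball: "act u x = act h x" if "u \<in> ball h e" for u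
  proof (rule ccontr)
    assume "act u x \<noteq> act h x"
    with that have "ball h e \<inter> (\<lambda>u. act u x) -` (- {act h x}) \<noteq> {}"
      by auto
    moreover have "open (- {act h x})" by auto
    then have "open (ball h e \<inter> (\<lambda>u. act u x) -` (- {act h x}))"
      by (rule open_Int[OF open_ball open_vimage[OF _ continuous_act_left]])
    ultimately obtain j where "D j \<in> ball h e \<inter> (\<lambda>u. act u x) -` (- {act h x})"
      using dense by meson
    then have "D j \<in> ball h e" "act (D j) x \<noteq> act h x"
      by auto
    then show False using const by (simp add: dist_commute)
  qed
  \<comment> \<open>Left translation by \<open>h + - g\<close> sends \<open>g\<close> to
    \<open>h\<close>, so the preimage of the ball is a neighbourhood of \<open>g\<close>. Undoing it
    on the left applies one fixed element to the constant value \<open>act h x\<close>.\<close>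
  have "continuous_on UNIV (\<lambda>v. (h + - g) + v)"
    by (intro continuous_intros)
  then have "open ((\<lambda>v. (h + - g) + v) -` ball h e)"
    by (rule open_vimage[OF open_ball])
  moreover have "g \<in> (\<lambda>v. (h + - g) + v) -` ball h e"
    using \<open>e > 0\<close> by (simp add: add.assoc)
  ultimately obtain j where j: "(h + - g) + D j \<in> ball h e"
    using dense[of "(\<lambda>v. (h + - g) + v) -` ball h e"] by blast
  have "D j = (g + - h) + ((h + - g) + D j)"
    by (simp add: add.assoc del: add_uminus_conv_diff)
  then have "act (D j) x = act (g + - h) (act ((h + - g) + D j) x)"
    by (metis act_add)
  also have "\<dots> = act (g + - h) (act h x)"
    using ball[OF j] by simp
  also have "\<dots> = act g x"
    by (simp add: act_add[symmetric] add.assoc)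
  finally show ?thesis by metis
qed

lemma edge_exists: "\<exists>z. edge x (act g x) z"
proof (cases "\<forall>i k. \<exists>j. dist (D j) (D i) < (1/2) ^ k \<and> act (D j) x \<noteq> act (D i) x")
  case True
  then show ?thesis by (intro edge_exists_moved) auto
next
  case False
  then obtain i k where "\<And>j. dist (D j) (D i) < (1/2) ^ k \<Longrightarrow> act (D j) x = act (D i) x"
    by blast
  then have "\<exists>j. act g x = act (D j) x"
    by (rule dense_orbit_of_constant_ball) auto
  then show ?thesis unfolding edge_def by blast
qed

section \<open>The Borel hypergraph, and the orbit relation as an analytic equivalence\<close>

lemma borel_hypergraph_edges: "borel_hypergraph 3 {{x, y, z} | x y z. edge x y z}"
  (is "borel_hypergraph 3 ?G")
  unfolding borel_hypergraph_def
proof (intro conjI ballI)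
  fix e assume "e \<in> ?G"
  then obtain x y z where e: "e = {x, y, z}" by blast
  have "card {x, y, z} \<le> 3" by (simp add: card_insert_if)
  then show "finite e" "card e \<le> 3" using e by auto
next
  let ?I = "{..<3::nat}"
  let ?M = "Pi\<^sub>M ?I (\<lambda>_. borel :: 'a measure)"
  \<comment> \<open>Enumerations may permute and repeat points, so the roles of \<open>x\<close>,
    \<open>y\<close>, \<open>z\<close> are assigned to coordinates in all finitely many
    ways.\<close>
  have eq: "t ` ?I \<in> ?G \<longleftrightarrow> (\<exists>i\<in>?I. \<exists>j\<in>?I. \<exists>k\<in>?I. edge (t i) (t j) (t k) \<and>
      (\<forall>l\<in>?I. t l = t i \<or> t l = t j \<or> t l = t k))" for t :: "nat \<Rightarrow> 'a"
  proof
    assume "t ` ?I \<in> ?G"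
    then obtain x y z where xyz: "t ` ?I = {x, y, z}" "edge x y z" by blast
    then have "x \<in> t ` ?I" "y \<in> t ` ?I" "z \<in> t ` ?I" by auto
    then obtain i j k where ijk: "i \<in> ?I" "j \<in> ?I" "k \<in> ?I" "x = t i" "y = t j" "z = t k"
      by (elim imageE)
    have "t l = t i \<or> t l = t j \<or> t l = t k" if "l \<in> ?I" for l
      using xyz(1) ijk that by blast
    with ijk xyz(2) show "\<exists>i\<in>?I. \<exists>j\<in>?I. \<exists>k\<in>?I. edge (t i) (t j) (t k) \<and>
      (\<forall>l\<in>?I. t l = t i \<or> t l = t j \<or> t l = t k)"
      by blast
  next
    assume "\<exists>i\<in>?I. \<exists>j\<in>?I. \<exists>k\<in>?I. edge (t i) (t j) (t k) \<and>
      (\<forall>l\<in>?I. t l = t i \<or> t l = t j \<or> t l = t k)"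
    then obtain i j k where ijk: "i \<in> ?I" "j \<in> ?I" "k \<in> ?I" "edge (t i) (t j) (t k)"
      "\<forall>l\<in>?I. t l = t i \<or> t l = t j \<or> t l = t k"
      by blast
    then have "t ` ?I = {t i, t j, t k}" by blast
    with ijk(4) show "t ` ?I \<in> ?G" by blast
  qed
  have coord: "(\<lambda>t. t i) \<in> borel_measurable ?M" if "i \<in> ?I" for i
    using that by (rule measurable_component_singleton)
  have "Measurable.pred ?M (\<lambda>t. t ` ?I \<in> ?G)"
    unfolding eq
    by (intro pred_intros_finite(3,4) pred_intros_logic(3,5) finite_lessThan
        pred_edge[OF coord coord coord] pred_eq_borel[OF coord coord])
  then have "{t \<in> space ?M. t ` ?I \<in> ?G} \<in> sets ?M"
    by (simp add: pred_def)
  then show "{t \<in> ?I \<rightarrow>\<^sub>E UNIV. t ` ?I \<in> ?G} \<in> sets ?M"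
    by (simp add: space_PiM)
qed

lemma equiv_orbit_equivalence: "equiv UNIV (orbit_equivalence act)"
proof (rule equivI)
  show "refl_on UNIV (orbit_equivalence act)"
    by (auto simp: refl_on_def orbit_equivalence_def intro: exI[of _ 0])
  show "sym (orbit_equivalence act)"
  proof (rule symI)
    fix x y assume "(x, y) \<in> orbit_equivalence act"
    then obtain g where "y = act g x" by (auto simp: orbit_equivalence_def)
    then have "x = act (- g) y" by (simp add: act_add[symmetric])
    then show "(y, x) \<in> orbit_equivalence act" by (auto simp: orbit_equivalence_def)
  qed
  show "trans (orbit_equivalence act)"
    by (rule transI) (auto simp: orbit_equivalence_def act_add[symmetric])
qed auto

text \<open>The relation is the image of the Polish product of group and space under the continuous
  map from \<open>(g, x)\<close> to \<open>(x, act g x)\<close>.\<close>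

lemma analytic_orbit_equivalence: "analytic_set (orbit_equivalence act)"
proof -
  have "continuous_on UNIV (\<lambda>p. (snd p, case p of (g, x) \<Rightarrow> act g x))"
    by (intro continuous_on_Pair continuous_act continuous_intros)
  then have "analytic_set (range (\<lambda>p. (snd p, case p of (g, x) \<Rightarrow> act g x)))"
    by (rule analytic_set_continuous_range)
  also have "range (\<lambda>p. (snd p, case p of (g, x) \<Rightarrow> act g x)) = orbit_equivalence act"
    by (auto simp: orbit_equivalence_def image_def)
  finally show ?thesis .
qed

lemma strongly_borel_hypergraphable_orbit_equivalence:
  "strongly_borel_hypergraphable 3 (orbit_equivalence act)"
  unfolding strongly_borel_hypergraphable_def
proof (intro conjI exI[of _ "{{x, y, z} | x y z. edge x y z}"] ballI allI impI
    equiv_orbit_equivalence analytic_orbit_equivalence borel_hypergraph_edges)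
  fix e assume "e \<in> {{x, y, z} | x y z. edge x y z}"
  then obtain x y z where e: "e = {x, y, z}" "edge x y z" by blast
  have "{x, y, z} \<subseteq> orbit_equivalence act `` {x}"
    using edge_in_orbit[OF e(2)] by (auto simp: orbit_equivalence_def intro: exI[of _ 0])
  then show "\<exists>C\<in>UNIV // orbit_equivalence act. e \<subseteq> C"
    unfolding e(1) by (rule bexI[OF _ quotientI]) simp
next
  fix x y assume "(x, y) \<in> orbit_equivalence act"
  then obtain g where "y = act g x" by (auto simp: orbit_equivalence_def)
  then obtain z where "edge x y z" using edge_exists by blast
  then show "\<exists>e\<in>{{x, y, z} | x y z. edge x y z}. x \<in> e \<and> y \<in> e"
    by (intro bexI[of _ "{x, y, z}"]) auto
qed

end

theorem theorem6p3:
  fixes act :: "'g::{polish_space, topological_group_add} \<Rightarrow> 'a::polish_space \<Rightarrow> 'a"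
  assumes "continuous_group_action act"
  shows "strongly_borel_hypergraphable 3 (orbit_equivalence act)"
proof -
  obtain D :: "nat \<Rightarrow> 'g" where "\<And>U. open U \<Longrightarrow> U \<noteq> {} \<Longrightarrow> \<exists>n. D n \<in> U"
    using dense_sequence_exists by blast
  with assms interpret polish_action act D
    by unfold_locales
  show ?thesis
    by (rule strongly_borel_hypergraphable_orbit_equivalence)
qed

end
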